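(* Let $a,b,c,d\in\mathbb{C}$ with $c\neq 0$ and $ad-bc=1$, and let $f(z)=\frac{az+b}{cz+d}$ be the corresponding Möbius map on $\hat{\mathbb{C}}=\mathbb{C}\cup\{\infty\}$. Suppose that $f$ is elliptic, that is, $a+d$ is real and $-2<a+d<2$. Let $b_0\in\mathbb{C}$ and let $\{b_n\}_{n\in\mathbb{N}_0}$ be the solution of $b_{n+1}=f(b_n)$ for $n\in\mathbb{N}_0$. Then either $f^k(b_0)=\infty$ for some $k\in\mathbb{N}$, or $\{b_n\}_{n\in\mathbb{N}_0}$ is a sequence in $\mathbb{C}$ that has no Hyers-Ulam stability.
   Context: $\mathbb{N}=\{1,2,3,\dots\}$, $\mathbb{N}_0=\mathbb{N}\cup\{0\}$; $f^k$ is the $k$-fold composition of $f$. The map is defined at the special points by $f(-d/c)=\infty$ and $f(\infty)=a/c$. Hyers-Ulam stability (here in $\mathbb{C}$): the difference equation $b_{n+1}=f(b_n)$ ($n\in\mathbb{N}_0$) has Hyers-Ulam stability if there is a function $G:(0,\infty)\to(0,\infty)$ with $G(\varepsilon)\to 0$ as $\varepsilon\to 0$ such that for every $\varepsilon>0$ and every sequence $\{a_n\}_{n\in\mathbb{N}_0}$ in $\mathbb{C}$ with $f(a_n)\neq\infty$ and $|a_{n+1}-f(a_n)|\le\varepsilon$ for all $n\in\mathbb{N}_0$, there is a sequence $\{b_n\}_{n\in\mathbb{N}_0}$ in $\mathbb{C}$ satisfying $b_{n+1}=f(b_n)$ and $|a_n-b_n|\le G(\varepsilon)$ for all $n\in\mathbb{N}_0$.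 A sequence $\{b_n\}$ solving the difference equation is said to have no Hyers-Ulam stability if the difference equation it solves does not have Hyers-Ulam stability. *)

theory Defs
  imports Complex_Main
begin

text \<open>The extended complex plane: \<open>Some z\<close> is the finite point \<open>z\<close>.\<close>

type_synonym ext_complex = "complex option"

abbreviation point_at_infinity :: ext_complex where
  "point_at_infinity \<equiv> None"

definition mobius :: "complex \<Rightarrow> complex \<Rightarrow> complex \<Rightarrow> complex \<Rightarrow> ext_complex \<Rightarrow> ext_complex" where
  "mobius a b c d w = (case w of
     None \<Rightarrow> if c = 0 then point_at_infinity else Some (a / c)
   | Some z \<Rightarrow> if c * z + d = 0 then point_at_infinity else Some ((a * z + b) / (c * z + d)))"

definition solves :: "(ext_complex \<Rightarrow> ext_complex) \<Rightarrow> (nat \<Rightarrow> ext_complex) \<Rightarrow> bool" where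
  "solves f b \<longleftrightarrow> (\<forall>n. b (Suc n) = f (b n))"

text \<open>
  All sequences in the next definition are sequences of finite points. The equation
  \<open>f (Some (u n)) = Some w\<close> says that \<open>f (u n)\<close> is not the point at infinity and names its value.
  \<open>G\<close> is only constrained on the positive reals, hence the one-sided limit.
\<close>

definition hyers_ulam_stable :: "(ext_complex \<Rightarrow> ext_complex) \<Rightarrow> bool" where
  "hyers_ulam_stable f \<longleftrightarrow>
     (\<exists>G :: real \<Rightarrow> real.
        (\<forall>\<epsilon>>0. G \<epsilon> > 0) \<and> (G \<longlongrightarrow> 0) (at_right 0) \<and>
        (\<forall>\<epsilon>>0. \<forall>u :: nat \<Rightarrow> complex.
           (\<forall>n. \<exists>w. f (Some (u n)) = Some w \<and> cmod (u (Suc n) - w) \<le> \<epsilon>) \<longrightarrow>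
           (\<exists>v :: nat \<Rightarrow> complex.
              solves f (\<lambda>n. Some (v n)) \<and> (\<forall>n. cmod (u n - v n) \<le> G \<epsilon>))))"

text \<open>Lack of stability of a solution is by convention lack of stability of the equation it solves.\<close>

definition no_hyers_ulam_stability ::
    "(ext_complex \<Rightarrow> ext_complex) \<Rightarrow> (nat \<Rightarrow> ext_complex) \<Rightarrow> bool" where
  "no_hyers_ulam_stability f b \<longleftrightarrow> solves f b \<and> \<not> hyers_ulam_stable f"

end

(* An elliptic map is conjugate, via z |-> (z - p) / (z - q) with p and q its fixed points, to a
   rotation w |-> l * w.  Exact orbits therefore stay on circles |w| = const, whereas an approximate
   orbit with arbitrarily small error can spiral from w = 0 out to |w| = 1/2: an exact orbit that
   starts close to it remains close to p and loses it. *)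

theory Submission
  imports Defs
begin

lemma mobius_Some_eq_Some_iff:
  "mobius a b c d (Some z) = Some w \<longleftrightarrow> c * z + d \<noteq> 0 \<and> w = (a * z + b) / (c * z + d)"
  by (auto simp: mobius_def)

lemma solves_eq_funpow:
  assumes "solves f bs"
  shows "bs n = (f ^^ n) (bs 0)"
  using assms by (induction n) (auto simp: solves_def)

text \<open>The numbers \<open>\<mu>\<close> and \<open>cnj \<mu>\<close> are the eigenvalues of a
  matrix of trace \<open>t\<close> and determinant 1. The discriminant \<open>t^2 - 4\<close> is
  negative, so they form a non-real conjugate pair on the unit circle.\<close>

lemma elliptic_eigenvalue_exists:
  fixes t :: complex
  assumes "t \<in> \<real>" "- 2 < Re t" "Re t < 2"
  obtains \<mu> where "\<mu> + cnj \<mu> = t" "\<mu> * cnj \<mu> = 1" "\<mu> \<noteq> cnj \<mu>"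
proof
  define s where "s = 4 - (Re t)\<^sup>2"
  have s: "s > 0"
    using assms(2,3) abs_square_less_1[of "Re t / 2"] by (simp add: s_def power_divide abs_if)
  define \<mu> where "\<mu> = Complex (Re t / 2) (sqrt s / 2)"
  show "\<mu> + cnj \<mu> = t"
    using assms(1) by (auto simp: \<mu>_def complex_eq_iff complex_is_Real_iff)
  show "\<mu> * cnj \<mu> = 1"
    using s by (simp add: \<mu>_def complex_eq_iff power2_eq_square[symmetric] power_divide)
      (simp add: s_def field_simps)
  show "\<mu> \<noteq> cnj \<mu>"
    using s by (simp add: \<mu>_def complex_eq_iff)
qed

text \<open>The fixed point \<open>(\<mu> - d) / c\<close> is where the denominator
  \<open>c * z + d\<close> equals the eigenvalue \<open>\<mu>\<close>. Dividing this identity by the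
  one with \<open>\<mu>\<close> and \<open>\<nu>\<close> exchanged cancels \<open>c * z + d\<close>
  and leaves the multiplier \<open>\<nu> / \<mu>\<close>.\<close>

lemma mobius_minus_fixed_point:
  fixes a b c d z \<mu> \<nu> :: complex
  assumes "c \<noteq> 0" "a * d - b * c = 1" "\<mu> + \<nu> = a + d" "\<mu> * \<nu> = 1" "c * z + d \<noteq> 0"
  shows "(a * z + b) / (c * z + d) - (\<mu> - d) / c = \<nu> * (z - (\<mu> - d) / c) / (c * z + d)"
proof -
  have a: "a = \<mu> + \<nu> - d"
    using assms(3) by (simp add: algebra_simps)
  have b: "b * c = a * d - \<mu> * \<nu>"
    using assms(2,4) by (simp add: algebra_simps)
  have "c * (a * z + b) - (\<mu> - d) * (c * z + d) = \<nu> * (c * z - (\<mu> - d))"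
    using b unfolding a by (simp add: algebra_simps)
  then show ?thesis
    using assms(1,5) by (simp add: field_simps)
qed

text \<open>The inverse of \<open>z \<mapsto> (z - p) / (z - q)\<close>.\<close>

definition unrotate :: "complex \<Rightarrow> complex \<Rightarrow> complex \<Rightarrow> complex" where
  "unrotate p q w = (p - q * w) / (1 - w)"

lemma unrotate_minus:
  assumes "w \<noteq> 1" "w' \<noteq> 1"
  shows "unrotate p q w - unrotate p q w' = (p - q) * (w - w') / ((1 - w) * (1 - w'))"
  using assms by (simp add: unrotate_def divide_simps) (simp add: algebra_simps)

text \<open>The disc of radius 1/2 keeps distance 1/2 from the pole at 1, so each denominator costs
  a factor of at most 2. This turns errors in the rotated coordinate into errors in the
  plane.\<close>

lemma unrotate_Lipschitz:
  assumes "cmod w \<le> 1/2" "cmod w' \<le> 1/2"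
  shows "cmod (unrotate p q w - unrotate p q w') \<le> 4 * cmod (p - q) * cmod (w - w')"
proof -
  have *: "1/2 \<le> cmod (1 - x)" if "cmod x \<le> 1/2" for x
    using norm_triangle_ineq2[of 1 x] that by simp
  have "1/4 \<le> cmod (1 - w) * cmod (1 - w')"
    using mult_mono[OF *[OF assms(1)] *[OF assms(2)]] by simp
  then have "cmod (p - q) * cmod (w - w') / (cmod (1 - w) * cmod (1 - w'))
      \<le> cmod (p - q) * cmod (w - w') / (1/4)"
    by (intro divide_left_mono) auto
  moreover have "w \<noteq> 1" "w' \<noteq> 1"
    using assms by auto
  ultimately show ?thesis
    by (simp add: unrotate_minus norm_mult norm_divide)
qed

text \<open>Since \<open>unrotate p q 0 = p\<close> and \<open>cmod (1 - w) \<le> 3/2\<close>, the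
  factor is at least (1/2) / (3/2). It measures how far from \<open>p\<close> the spiral
  ends.\<close>

lemma norm_unrotate_minus_ge:
  assumes "cmod w = 1/2"
  shows "cmod (p - q) / 3 \<le> cmod (unrotate p q w - p)"
proof -
  have "w \<noteq> 1"
    using assms by auto
  then have "cmod (unrotate p q w - p) = cmod (p - q) * cmod w / cmod (1 - w)"
    using unrotate_minus[of w 0 p q] by (simp add: unrotate_def norm_mult norm_divide)
  moreover have "cmod (1 - w) \<le> 3/2" "cmod (1 - w) > 0"
    using norm_triangle_ineq4[of 1 w] assms \<open>w \<noteq> 1\<close> by auto
  then have "cmod (p - q) * (1/2) / (3/2) \<le> cmod (p - q) * (1/2) / cmod (1 - w)"
    by (intro divide_left_mono) auto
  ultimately show ?thesis
    by (simp add: assms)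
qed

text \<open>The conjugacy with a rotation. The value 1 of the coordinate stands for infinity, so the
  two inequations on \<open>w\<close> keep the point and its image finite.\<close>

lemma mobius_unrotate:
  fixes a b c d \<mu> \<nu> w :: complex
  assumes "c \<noteq> 0" "a * d - b * c = 1" "\<mu> + \<nu> = a + d" "\<mu> * \<nu> = 1"
    and "w \<noteq> 1" "\<nu> * w \<noteq> \<mu>"
  defines "p \<equiv> (\<mu> - d) / c" and "q \<equiv> (\<nu> - d) / c"
  shows "mobius a b c d (Some (unrotate p q w)) = Some (unrotate p q (\<nu> / \<mu> * w))"
proof -
  have "\<mu> \<noteq> 0"
    using assms(4) by auto
  have den: "c * unrotate p q w + d = (\<mu> - \<nu> * w) / (1 - w)"
    using assms(1,5) by (simp add: unrotate_def p_def q_def field_simps)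
  have nz: "c * unrotate p q w + d \<noteq> 0"
    using assms(5,6) by (simp add: den)
  have "unrotate p q w - p = (p - q) * w / (1 - w)"
    using unrotate_minus[of w 0 p q] assms(5) by (simp add: unrotate_def)
  with mobius_minus_fixed_point[OF assms(1-4) nz]
  have "(a * unrotate p q w + b) / (c * unrotate p q w + d) - p
      = \<nu> * ((p - q) * w / (1 - w)) / ((\<mu> - \<nu> * w) / (1 - w))"
    by (simp add: p_def[symmetric] den)
  also have "\<dots> = (p - q) * (\<nu> / \<mu> * w) / (1 - \<nu> / \<mu> * w)"
    using assms(5,6) \<open>\<mu> \<noteq> 0\<close> by (simp add: divide_simps)
  also have "\<dots> = unrotate p q (\<nu> / \<mu> * w) - p"
    using unrotate_minus[of "\<nu> / \<mu> * w" 0 p q] assms(6) \<open>\<mu> \<noteq> 0\<close>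
    by (simp add: unrotate_def field_simps)
  finally show ?thesis
    using nz by (simp add: mobius_Some_eq_Some_iff)
qed

text \<open>The modulus of \<open>(z - p) / (z - q)\<close> is constant along orbits; the equation is
  cross-multiplied because \<open>v n = q\<close> is possible.\<close>

lemma elliptic_orbit_invariant:
  fixes a b c d \<mu> \<nu> :: complex and v :: "nat \<Rightarrow> complex"
  assumes "c \<noteq> 0" "a * d - b * c = 1" "\<mu> + \<nu> = a + d" "\<mu> * \<nu> = 1"
    and "cmod \<mu> = 1" "cmod \<nu> = 1"
    and "solves (mobius a b c d) (\<lambda>n. Some (v n))"
  defines "p \<equiv> (\<mu> - d) / c" and "q \<equiv> (\<nu> - d) / c"
  shows "cmod (v n - p) * cmod (v 0 - q) = cmod (v 0 - p) * cmod (v n - q)"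
proof (induction n)
  case (Suc n)
  have step: "c * v n + d \<noteq> 0" "v (Suc n) = (a * v n + b) / (c * v n + d)"
    using assms(7) mobius_Some_eq_Some_iff[of a b c d "v n" "v (Suc n)"]
    by (auto simp: solves_def)
  \<comment> \<open>The factors \<open>\<nu>\<close> and \<open>\<mu>\<close> have modulus 1, so one
    step divides the distances to \<open>p\<close> and to \<open>q\<close> by the same
    number.\<close>
  have "cmod (v (Suc n) - p) = cmod (v n - p) / cmod (c * v n + d)"
    using mobius_minus_fixed_point[OF assms(1-4) step(1)] assms(6)
    by (simp add: step(2) p_def norm_mult norm_divide)
  moreover have "cmod (v (Suc n) - q) = cmod (v n - q) / cmod (c * v n + d)"
    using mobius_minus_fixed_point[of c a d b \<nu> \<mu>, OF _ _ _ _ step(1)] assms(1-5)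
    by (simp add: step(2) q_def norm_mult norm_divide add.commute mult.commute)
  ultimately show ?case
    using Suc by simp
qed simp

lemma elliptic_not_hyers_ulam_stable:
  fixes a b c d :: complex
  assumes "c \<noteq> 0" "a * d - b * c = 1"
    and "a + d \<in> \<real>" "- 2 < Re (a + d)" "Re (a + d) < 2"
  shows "\<not> hyers_ulam_stable (mobius a b c d)"
proof
  assume "hyers_ulam_stable (mobius a b c d)"
  then obtain G :: "real \<Rightarrow> real" where G: "(G \<longlongrightarrow> 0) (at_right 0)"
    and shadow: "\<And>\<epsilon> u. \<epsilon> > 0 \<Longrightarrow>
      (\<And>n. \<exists>w. mobius a b c d (Some (u n)) = Some w \<and> cmod (u (Suc n) - w) \<le> \<epsilon>) \<Longrightarrow>
      \<exists>v. solves (mobius a b c d) (\<lambda>n. Some (v n)) \<and> (\<forall>n. cmod (u n - v n) \<le> G \<epsilon>)"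
    unfolding hyers_ulam_stable_def by blast
  obtain \<mu> where \<mu>: "\<mu> + cnj \<mu> = a + d" "\<mu> * cnj \<mu> = 1" "\<mu> \<noteq> cnj \<mu>"
    using elliptic_eigenvalue_exists[OF assms(3-5)] .
  have norm_\<mu>: "cmod \<mu> = 1"
    using arg_cong[OF \<mu>(2), of cmod] by (simp add: norm_mult power2_eq_square[symmetric] abs_square_eq_1)
  define p q where "p = (\<mu> - d) / c" and "q = (cnj \<mu> - d) / c"
  define D where "D = cmod (p - q)"
  have D: "D > 0"
    using \<mu>(3) assms(1) by (simp add: D_def p_def q_def)
  \<comment> \<open>A single error bound suffices: D/10 is well below the distance D/3 from
    \<open>p\<close> that the spiral reaches.\<close>
  have "\<forall>\<^sub>F \<epsilon> in at_right 0. G \<epsilon> < D / 10 \<and> \<epsilon> > 0"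
    using order_tendstoD(2)[OF G, of "D / 10"] D eventually_at_right_less[of "0 :: real"]
    by (auto intro: eventually_conj)
  then obtain \<epsilon> where \<epsilon>: "\<epsilon> > 0" "G \<epsilon> < D / 10"
    using eventually_happens'[OF trivial_limit_at_right_real] by blast
  \<comment> \<open>The radial step: \<open>4 * D\<close> is the Lipschitz constant of
    \<open>unrotate\<close> on the disc of radius 1/2.\<close>
  define \<eta> where "\<eta> = \<epsilon> / (4 * D)"
  have \<eta>: "\<eta> > 0" "4 * D * \<eta> = \<epsilon>"
    using \<epsilon>(1) D by (auto simp: \<eta>_def)
  \<comment> \<open>The radius grows linearly and then stays at 1/2, inside the disc where the
    Lipschitz bound holds.\<close>
  define r where "r n = min (1/2) (real n * \<eta>)" for n
  have r: "0 \<le> r n" "r n \<le> 1/2" "\<bar>r (Suc n) - r n\<bar> \<le> \<eta>" for n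
    using \<eta>(1) by (auto simp: r_def min_def algebra_simps)
  define l where "l = cnj \<mu> / \<mu>"
  have l: "cmod l = 1"
    using norm_\<mu> by (simp add: l_def norm_divide)
  \<comment> \<open>The power of \<open>l\<close> follows the rotation exactly, so only the change
    of radius contributes to the error.\<close>
  define w where "w n = l ^ n * of_real (r n)" for n
  have w: "cmod (w n) = r n" for n
    using r by (simp add: w_def norm_mult norm_power l)
  define u where "u n = unrotate p q (w n)" for n
  have "\<exists>z. mobius a b c d (Some (u n)) = Some z \<and> cmod (u (Suc n) - z) \<le> \<epsilon>" for n
  proof (intro exI conjI)
    have "w n \<noteq> 1"
      using w[of n] r(2)[of n] by auto
    moreover have "cmod (cnj \<mu> * w n) \<noteq> cmod \<mu>"
      using w[of n] r(2)[of n] by (simp add: norm_mult norm_\<mu>)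
    ultimately show "mobius a b c d (Some (u n)) = Some (unrotate p q (l * w n))"
      unfolding u_def l_def p_def q_def
      by (intro mobius_unrotate[OF assms(1,2) \<mu>(1,2)]) auto
    have "w (Suc n) - l * w n = l ^ Suc n * of_real (r (Suc n) - r n)"
      by (simp add: w_def algebra_simps)
    then have "cmod (w (Suc n) - l * w n) \<le> \<eta>"
      using r(3)[of n] by (simp only: norm_mult norm_power l norm_of_real) simp
    then have "4 * D * cmod (w (Suc n) - l * w n) \<le> \<epsilon>"
      using D by (simp flip: \<eta>(2))
    moreover have "cmod (w (Suc n)) \<le> 1/2" "cmod (l * w n) \<le> 1/2"
      using r(2) by (simp_all only: norm_mult l w mult_1)
    ultimately show "cmod (u (Suc n) - unrotate p q (l * w n)) \<le> \<epsilon>"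
      unfolding u_def D_def using unrotate_Lipschitz order_trans by blast
  qed
  then obtain v where v: "solves (mobius a b c d) (\<lambda>n. Some (v n))"
    and close: "\<And>n. cmod (u n - v n) \<le> G \<epsilon>"
    using shadow[OF \<epsilon>(1), of u] by blast
  obtain N where N: "1/2 \<le> real N * \<eta>"
    using reals_Archimedean3[OF \<eta>(1)] less_imp_le by blast
  then have "cmod (w N) = 1/2"
    by (simp add: w r_def)
  then have uN: "D / 3 \<le> cmod (u N - p)"
    using norm_unrotate_minus_ge[of "w N" p q] by (simp add: u_def D_def)
  define x where "x = cmod (v N - p)"
  \<comment> \<open>Here 7/30 = 1/3 - 1/10.\<close>
  have x: "x > D * (7/30)"
    using norm_triangle_ineq[of "u N - v N" "v N - p"] close[of N] uN \<epsilon>(2) by (simp add: x_def)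
  have u0: "u 0 = p"
    by (simp add: u_def w_def r_def unrotate_def)
  have v0p: "cmod (v 0 - p) \<le> D / 10"
    using close[of 0] \<epsilon>(2) by (simp add: u0 norm_minus_commute)
  have v0q: "D * (9/10) \<le> cmod (v 0 - q)"
    using norm_triangle_ineq[of "p - v 0" "v 0 - q"] v0p by (simp add: D_def norm_minus_commute)
  have vNq: "cmod (v N - q) \<le> x + D"
    using norm_triangle_ineq[of "v N - p" "p - q"] by (simp add: x_def D_def)
  \<comment> \<open>The invariant, with \<open>v 0\<close> near \<open>p\<close> and far from
    \<open>q\<close>, forces \<open>8 * x \<le> D\<close>, whereas 7/30 exceeds 1/8.\<close>
  have "D * (9/10) * x \<le> x * cmod (v 0 - q)"
    using mult_left_mono[OF v0q, of x] by (simp add: x_def mult.commute)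
  also have "\<dots> = cmod (v 0 - p) * cmod (v N - q)"
    using elliptic_orbit_invariant[OF assms(1,2) \<mu>(1,2) _ _ v, of N] norm_\<mu>
    by (simp add: x_def p_def q_def)
  also have "\<dots> \<le> D / 10 * (x + D)"
    using v0p vNq D by (intro mult_mono) auto
  finally have "9 * x \<le> x + D"
    using D by (simp add: field_simps)
  with x D show False
    by simp
qed

theorem theorem5p4:
  fixes a b c d b0 :: complex
    and f :: "ext_complex \<Rightarrow> ext_complex"
    and bs :: "nat \<Rightarrow> ext_complex"
  assumes "c \<noteq> 0" and "a * d - b * c = 1"
    and "f = mobius a b c d"
    and "a + d \<in> \<real>" and "- 2 < Re (a + d)" and "Re (a + d) < 2"
    and "bs 0 = Some b0" and "solves f bs"
  shows "(\<exists>k::nat. k \<ge> 1 \<and> (f ^^ k) (Some b0) = point_at_infinity) \<or>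
    ((\<forall>n. bs n \<noteq> point_at_infinity) \<and> no_hyers_ulam_stability f bs)"
proof (rule disjCI)
  assume *: "\<not> ((\<forall>n. bs n \<noteq> point_at_infinity) \<and> no_hyers_ulam_stability f bs)"
  \<comment> \<open>Instability concerns the equation and holds for every starting point, so only
    finiteness of the orbit can fail.\<close>
  have "no_hyers_ulam_stability f bs"
    using assms elliptic_not_hyers_ulam_stable by (simp add: no_hyers_ulam_stability_def)
  with * obtain k where k: "bs k = point_at_infinity"
    by blast
  moreover have "k \<noteq> 0"
    using k assms(7) by (intro notI) simp
  ultimately show "\<exists>k::nat. k \<ge> 1 \<and> (f ^^ k) (Some b0) = point_at_infinity"
    using solves_eq_funpow[OF assms(8), of k] assms(7) by (intro exI[of _ k]) auto
qed

end
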